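(* Let $\mathfrak{R}=(R_k(X),\zeta_k(X))_{1\leq k\leq K}$ be a data-dependent collection of subsets $R_k$ of $\mathbb{N}_m$ and of integers $\zeta_k$. Then for any $\mathcal{H}_0\subset\mathbb{N}_m$, the event $\mathcal{E}(\mathfrak{R},\mathcal{H}_0)$ satisfies $$\mathcal{E}(\mathfrak{R},\mathcal{H}_0)=\left\{\forall R\subset\mathbb{N}_m:\ |R\cap\mathcal{H}_0|\leq\overline{V}_{\mathfrak{R}}(R)\right\}=\left\{\forall R\subset\mathbb{N}_m:\ |R\cap\mathcal{H}_0|\leq V^*_{\mathfrak{R}}(R)\right\}.$$
   Context: $m\ge 1$ is an integer and $\mathbb{N}_m=\{1,\dots,m\}$. $X$ is a random observation; the sets $R_k=R_k(X)$, the integers $\zeta_k=\zeta_k(X)$ (and possibly the size $K\ge 1$) may depend on $X$. For $\mathcal{H}_0\subset\mathbb{N}_m$ define the event $$\mathcal{E}(\mathfrak{R},\mathcal{H}_0)=\{\forall k=1,\dots,K:\ |R_k(X)\cap\mathcal{H}_0|\leq\zeta_k(X)\}.$$ Let $\mathcal{A}(\mathfrak{R})=\{A\subset\mathbb{N}_m:\ \forall k=1,\dots,K,\ |R_k\cap A|\leq\zeta_k\}$. For $R\subset\mathbb{N}_m$ define $$V^*_{\mathfrak{R}}(R)=\max_{A\in\mathcal{A}(\mathfrak{R})}|R\cap A|,\qquad \overline{V}_{\mathfrak{R}}(R)=\min\Big(\min_{1\leq k\leq K}\big(|R\setminus R_k|+\zeta_k\big),\ |R|\Big),$$ with the convention that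 a maximum over an empty collection equals $-\infty$. *)

theory Defs
  imports "HOL-Probability.Probability"
begin

text \<open>
  A realized collection \<open>(R\<^sub>k, \<zeta>\<^sub>k)\<close>, \<open>1 \<le> k \<le> K\<close>, is given by its size \<open>K\<close> and two functions
  \<open>R\<close>, \<open>\<zeta>\<close> of the index; only their values on \<open>{1..K}\<close> matter. The bounds \<open>\<zeta>\<^sub>k\<close> are integers
  and may be negative, in which case \<open>ref_sets m K R \<zeta>\<close> is empty.
\<close>

definition ref_sets :: "nat \<Rightarrow> nat \<Rightarrow> (nat \<Rightarrow> nat set) \<Rightarrow> (nat \<Rightarrow> int) \<Rightarrow> nat set set" where
  "ref_sets m K R \<zeta> = {A. A \<subseteq> {1..m} \<and> (\<forall>k\<in>{1..K}. int (card (R k \<inter> A)) \<le> \<zeta> k)}"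

text \<open>
  Extended real values, since a maximum over an empty collection equals \<open>-\<infinity>\<close>, whereas
  \<^const>\<open>Max\<close> is unspecified on the empty set.
\<close>

definition V_star :: "nat \<Rightarrow> nat \<Rightarrow> (nat \<Rightarrow> nat set) \<Rightarrow> (nat \<Rightarrow> int) \<Rightarrow> nat set \<Rightarrow> ereal" where
  "V_star m K R \<zeta> S =
     (if ref_sets m K R \<zeta> = {} then - \<infinity>
      else Max ((\<lambda>A. ereal (real (card (S \<inter> A)))) ` ref_sets m K R \<zeta>))"

text \<open>Meaningful only for \<open>K \<ge> 1\<close>, so that the inner minimum is over a nonempty set.\<close>

definition V_bar :: "nat \<Rightarrow> (nat \<Rightarrow> nat set) \<Rightarrow> (nat \<Rightarrow> int) \<Rightarrow> nat set \<Rightarrow> int" where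
  "V_bar K R \<zeta> S =
     min (Min ((\<lambda>k. int (card (S - R k)) + \<zeta> k) ` {1..K})) (int (card S))"

text \<open>
  For a random observation \<open>X\<close> on the probability space \<open>M\<close>, the size, the sets and the bounds
  are functions of the observed value \<open>x = X \<omega>\<close>.
\<close>

definition event_E ::
  "'w measure \<Rightarrow> ('w \<Rightarrow> 'x) \<Rightarrow> ('x \<Rightarrow> nat) \<Rightarrow> (nat \<Rightarrow> 'x \<Rightarrow> nat set) \<Rightarrow> (nat \<Rightarrow> 'x \<Rightarrow> int)
    \<Rightarrow> nat set \<Rightarrow> 'w set" where
  "event_E M X K R \<zeta> H0 =
     {\<omega> \<in> space M. \<forall>k\<in>{1..K (X \<omega>)}. int (card (R k (X \<omega>) \<inter> H0)) \<le> \<zeta> k (X \<omega>)}"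

end

theory Submission
  imports Defs
begin

text \<open>
  The statement holds pointwise in the observation. For a realized collection, the event says
  exactly that \<open>H0\<close> belongs to \<^const>\<open>ref_sets\<close>.

  Splitting \<open>S\<close> along \<open>R\<^sub>k\<close> gives \<open>|S \<inter> H0| \<le> |S - R\<^sub>k| + |R\<^sub>k \<inter> H0|\<close>, hence the bound by
  \<^const>\<open>V_bar\<close>; conversely, the choice \<open>S = R\<^sub>k\<close> in that bound returns \<open>|R\<^sub>k \<inter> H0| \<le> \<zeta>\<^sub>k\<close>
  (\<open>ref_sets_iff_V_bar\<close>).

  If \<open>H0\<close> is in \<^const>\<open>ref_sets\<close>, it competes in the maximum defining \<^const>\<open>V_star\<close>. Conversely,
  the choice \<open>S = H0\<close> forces a maximizer \<open>A\<close> to contain \<open>H0\<close>, and \<^const>\<open>ref_sets\<close> is closed under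
  taking subsets (\<open>ref_sets_iff_V_star\<close>).
\<close>

lemma finite_ref_sets: "finite (ref_sets m K R \<zeta>)"
  by (rule finite_subset[of _ "Pow {1..m}"]) (auto simp: ref_sets_def)

lemma ref_sets_downward_closed:
  assumes "A \<in> ref_sets m K R \<zeta>" and "B \<subseteq> A"
  shows "B \<in> ref_sets m K R \<zeta>"
proof -
  have "finite A"
    using assms(1) by (auto simp: ref_sets_def intro: finite_subset)
  then have "card (R k \<inter> B) \<le> card (R k \<inter> A)" for k
    using assms(2) by (intro card_mono) auto
  then have "int (card (R k \<inter> B)) \<le> \<zeta> k" if "k \<in> {1..K}" for k
    using assms(1) that unfolding ref_sets_def
    by (metis (no_types, lifting) mem_Collect_eq of_nat_mono order_trans)
  then show ?thesis
    using assms by (auto simp: ref_sets_def)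
qed

lemma le_V_star_iff:
  "ereal (real n) \<le> V_star m K R \<zeta> S \<longleftrightarrow> (\<exists>A\<in>ref_sets m K R \<zeta>. n \<le> card (S \<inter> A))"
  using finite_ref_sets[of m K R \<zeta>] by (auto simp: V_star_def Max_ge_iff)

lemma le_V_bar_iff:
  assumes "K \<ge> 1"
  shows "x \<le> V_bar K R \<zeta> S \<longleftrightarrow>
    (\<forall>k\<in>{1..K}. x \<le> int (card (S - R k)) + \<zeta> k) \<and> x \<le> int (card S)"
  using assms by (simp add: V_bar_def)

lemma ref_sets_iff_V_bar:
  assumes "K \<ge> 1" and "\<And>k. k \<in> {1..K} \<Longrightarrow> R k \<subseteq> {1..m}" and "H \<subseteq> {1..m}"
  shows "H \<in> ref_sets m K R \<zeta> \<longleftrightarrow>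
    (\<forall>S. S \<subseteq> {1..m} \<longrightarrow> int (card (S \<inter> H)) \<le> V_bar K R \<zeta> S)"
proof
  assume H: "H \<in> ref_sets m K R \<zeta>"
  show "\<forall>S. S \<subseteq> {1..m} \<longrightarrow> int (card (S \<inter> H)) \<le> V_bar K R \<zeta> S"
  proof (intro allI impI)
    fix S :: "nat set"
    assume "S \<subseteq> {1..m}"
    then have "finite S"
      by (rule finite_subset) simp
    have "int (card (S \<inter> H)) \<le> int (card (S - R k)) + \<zeta> k" if k: "k \<in> {1..K}" for k
    proof -
      have "finite (R k \<inter> H)"
        using assms(3) by (auto intro: finite_subset)
      then have "card (S \<inter> H) \<le> card ((S - R k) \<union> (R k \<inter> H))"
        using \<open>finite S\<close> by (intro card_mono) auto
      also have "\<dots> \<le> card (S - R k) + card (R k \<inter> H)"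
        by (rule card_Un_le)
      finally have "int (card (S \<inter> H)) \<le> int (card (S - R k)) + int (card (R k \<inter> H))"
        by linarith
      moreover have "int (card (R k \<inter> H)) \<le> \<zeta> k"
        using H k by (simp add: ref_sets_def)
      ultimately show ?thesis
        by linarith
    qed
    then show "int (card (S \<inter> H)) \<le> V_bar K R \<zeta> S"
      using \<open>finite S\<close> assms(1) by (simp add: le_V_bar_iff card_mono)
  qed
next
  assume bound: "\<forall>S. S \<subseteq> {1..m} \<longrightarrow> int (card (S \<inter> H)) \<le> V_bar K R \<zeta> S"
  have "int (card (R k \<inter> H)) \<le> \<zeta> k" if k: "k \<in> {1..K}" for k
  proof -
    have "int (card (R k \<inter> H)) \<le> int (card (R k - R k)) + \<zeta> k"
      using bound assms(2)[OF k] k le_V_bar_iff[OF assms(1)] by blast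
    then show ?thesis
      by simp
  qed
  then show "H \<in> ref_sets m K R \<zeta>"
    using assms(3) by (simp add: ref_sets_def)
qed

lemma ref_sets_iff_V_star:
  assumes "H \<subseteq> {1..m}"
  shows "H \<in> ref_sets m K R \<zeta> \<longleftrightarrow>
    (\<forall>S. S \<subseteq> {1..m} \<longrightarrow> ereal (real (card (S \<inter> H))) \<le> V_star m K R \<zeta> S)"
proof
  assume "H \<in> ref_sets m K R \<zeta>"
  then show "\<forall>S. S \<subseteq> {1..m} \<longrightarrow> ereal (real (card (S \<inter> H))) \<le> V_star m K R \<zeta> S"
    unfolding le_V_star_iff by blast
next
  assume "\<forall>S. S \<subseteq> {1..m} \<longrightarrow> ereal (real (card (S \<inter> H))) \<le> V_star m K R \<zeta> S"
  then obtain A where A: "A \<in> ref_sets m K R \<zeta>" "card (H \<inter> H) \<le> card (H \<inter> A)"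
    using assms unfolding le_V_star_iff by blast
  have "finite H"
    using assms by (rule finite_subset) simp
  then have "H \<inter> A = H"
    using A(2) by (intro card_seteq) auto
  then show "H \<in> ref_sets m K R \<zeta>"
    using ref_sets_downward_closed[OF A(1)] by blast
qed

theorem proposition2p1:
  fixes m :: nat
    and M :: "'w measure" and N :: "'x measure" and X :: "'w \<Rightarrow> 'x"
    and K :: "'x \<Rightarrow> nat" and R :: "nat \<Rightarrow> 'x \<Rightarrow> nat set" and \<zeta> :: "nat \<Rightarrow> 'x \<Rightarrow> int"
    and H0 :: "nat set"
  assumes "m \<ge> 1"
    and "prob_space M"
    and "X \<in> measurable M N"
    and "\<And>x. x \<in> space N \<Longrightarrow> K x \<ge> 1"
    and "\<And>x k. x \<in> space N \<Longrightarrow> k \<in> {1..K x} \<Longrightarrow> R k x \<subseteq> {1..m}"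
    and "H0 \<subseteq> {1..m}"
  shows "event_E M X K R \<zeta> H0 =
      {\<omega> \<in> space M. \<forall>S. S \<subseteq> {1..m} \<longrightarrow>
         int (card (S \<inter> H0)) \<le> V_bar (K (X \<omega>)) (\<lambda>k. R k (X \<omega>)) (\<lambda>k. \<zeta> k (X \<omega>)) S}
    \<and> {\<omega> \<in> space M. \<forall>S. S \<subseteq> {1..m} \<longrightarrow>
         int (card (S \<inter> H0)) \<le> V_bar (K (X \<omega>)) (\<lambda>k. R k (X \<omega>)) (\<lambda>k. \<zeta> k (X \<omega>)) S} =
      {\<omega> \<in> space M. \<forall>S. S \<subseteq> {1..m} \<longrightarrow>
         ereal (real (card (S \<inter> H0)))
           \<le> V_star m (K (X \<omega>)) (\<lambda>k. R k (X \<omega>)) (\<lambda>k. \<zeta> k (X \<omega>)) S}"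
proof -
  have X: "X \<omega> \<in> space N" if "\<omega> \<in> space M" for \<omega>
    using assms(3) that by (rule measurable_space)
  have E: "event_E M X K R \<zeta> H0 =
      {\<omega> \<in> space M. H0 \<in> ref_sets m (K (X \<omega>)) (\<lambda>k. R k (X \<omega>)) (\<lambda>k. \<zeta> k (X \<omega>))}"
    using assms(6) by (simp add: event_E_def ref_sets_def)
  have bar: "H0 \<in> ref_sets m (K (X \<omega>)) (\<lambda>k. R k (X \<omega>)) (\<lambda>k. \<zeta> k (X \<omega>)) \<longleftrightarrow>
      (\<forall>S. S \<subseteq> {1..m} \<longrightarrow>
         int (card (S \<inter> H0)) \<le> V_bar (K (X \<omega>)) (\<lambda>k. R k (X \<omega>)) (\<lambda>k. \<zeta> k (X \<omega>)) S)"
    if "\<omega> \<in> space M" for \<omega>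
    by (rule ref_sets_iff_V_bar[OF assms(4)[OF X[OF that]] assms(5)[OF X[OF that]] assms(6)])
  note star = ref_sets_iff_V_star[OF assms(6)]
  show ?thesis
    unfolding E star[symmetric] using bar by blast
qed

end
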